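(* Let $p$ be an odd prime, let $\ell\ge 2$ be an integer not divisible by $p$, and let $L=2\ell$. Let $o_p(L)$ denote the order of the matrix $\mathcal V=AB$ in $\mathbf{GL}_L(\mathbb F_p)$. Then $$o_p(L)\le p^{L-1}-p.$$
   Context: Here $\mathbb F_p=\mathbb Z/p\mathbb Z$. For an even integer $L\ge 2$, $A$ is the $L\times L$ block-diagonal matrix over $\mathbb F_p$ with $L/2$ diagonal blocks all equal to $\begin{pmatrix}1&1\\1&-1\end{pmatrix}$. $C$ is the $L\times L$ cyclic shift (permutation) matrix, $Ce_i=e_{i+1}$ with indices modulo $L$, and $B=CAC^{-1}$. (So $B$ acts by the same $2\times 2$ block on the coordinate pairs $(2,3),(4,5),\dots,(L,1)$.) Since $p$ is odd, $A$ and $B$ are invertible. The order of $\mathcal V=AB$ is the smallest integer $T\ge 1$ with $\mathcal V^T=I$ over $\mathbb F_p$. *)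

theory Defs
  imports
    "Jordan_Normal_Form.Determinant"
    "Berlekamp_Zassenhaus.Finite_Field"
begin

definition block :: "'a :: field mat" where
  "block = mat_of_rows_list 2 [[1, 1], [1, -1]]"

definition matA :: "nat \<Rightarrow> 'a :: field mat" where
  "matA L = diag_block_mat (replicate (L div 2) block)"

text \<open>Indices run over \<open>0..<L\<close>; column \<open>j\<close> is the image of the basis vector \<open>e j\<close>,
  so this matrix sends \<open>e j\<close> to \<open>e ((j + 1) mod L)\<close>.\<close>

definition matC :: "nat \<Rightarrow> 'a :: field mat" where
  "matC L = mat L L (\<lambda>(i, j). if i = (j + 1) mod L then 1 else 0)"

definition matB :: "nat \<Rightarrow> 'a :: field mat" where
  "matB L = matC L * matA L * the (mat_inverse (matC L))"

definition matV :: "nat \<Rightarrow> 'a :: field mat" where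
  "matV L = matA L * matB L"

definition mat_order :: "'a :: semiring_1 mat \<Rightarrow> nat" where
  "mat_order M = (LEAST T. 1 \<le> T \<and> M ^\<^sub>m T = 1\<^sub>m (dim_row M))"

text \<open>\<open>the\<close> and \<open>LEAST\<close> above are unspecified when no witness exists.  The following facts show
  that for positive even \<open>L\<close> the matrix \<open>matC L\<close> is invertible and, over a finite field of odd
  characteristic, some positive power of \<open>matV L\<close> is the identity.\<close>

lemma pow_mat_finite_order:
  fixes M :: "'a :: {field, finite} mat"
  assumes M: "M \<in> carrier_mat n n" and N: "N \<in> carrier_mat n n" and MN: "M * N = 1\<^sub>m n"
  shows "\<exists>k\<ge>1. M ^\<^sub>m k = 1\<^sub>m n"
proof -
  let ?R = "ring_mat TYPE('a) n ()"
  interpret ring ?R by (rule ring_mat)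
  have NM: "N * M = 1\<^sub>m n" by (rule mat_mult_left_right_inverse[OF M N MN])
  have U: "M \<in> Units ?R" using M N MN NM by (auto simp: Units_def ring_mat_def)
  have fin: "finite (carrier_mat n n :: 'a mat set)"
  proof (rule finite_imageD)
    let ?f = "\<lambda>M :: 'a mat. \<lambda>x. if x \<in> {..<n} \<times> {..<n} then M $$ x else 0"
    show "finite (?f ` carrier_mat n n)"
      by (rule finite_subset[OF _ finite_set_of_finite_funs[of "{..<n} \<times> {..<n}" UNIV "0"]])
        auto
    show "inj_on ?f (carrier_mat n n)"
    proof (rule inj_onI, rule eq_matI)
      fix X Y :: "'a mat" and i j
      assume "X \<in> carrier_mat n n" "Y \<in> carrier_mat n n" "?f X = ?f Y"
        and "i < dim_row Y" "j < dim_col Y"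
      thus "X $$ (i, j) = Y $$ (i, j)" using fun_cong[of "?f X" "?f Y" "(i, j)"] by simp
    qed auto
  qed
  interpret u: group "units_of ?R" by (rule units_group)
  have fu: "finite (carrier (units_of ?R))"
    by (rule finite_subset[OF _ fin]) (auto simp: units_of_def Units_def ring_mat_def)
  have U': "M \<in> carrier (units_of ?R)" using U by (simp add: units_of_def)
  have "M [^]\<^bsub>units_of ?R\<^esub> order (units_of ?R) = \<one>\<^bsub>units_of ?R\<^esub>" 
    by (rule u.pow_order_eq_1[OF U'])
  hence "M [^]\<^bsub>?R\<^esub> order (units_of ?R) = 1\<^sub>m n" 
    using units_of_pow[OF U] by (simp add: units_of_def ring_mat_def)
  hence "M ^\<^sub>m order (units_of ?R) = 1\<^sub>m n" unfolding pow_mat_ring_pow[OF M, where b = "()"] .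
  moreover have "order (units_of ?R) > 0" using fu u.order_gt_0_iff_finite by blast
  ultimately show ?thesis by (intro exI[of _ "order (units_of ?R)"]) auto
qed

lemma matC_carrier [simp]: "matC L \<in> carrier_mat L L"
  by (simp add: matC_def)

lemma matC_transpose:
  assumes "0 < L"
  shows "matC L * transpose_mat (matC L) = (1\<^sub>m L :: 'a :: field mat)"
proof (rule eq_matI)
  fix i j assume "i < dim_row (1\<^sub>m L :: 'a mat)" "j < dim_col (1\<^sub>m L :: 'a mat)"
  hence ij: "i < L" "j < L" by auto
  define k where "k = (if i = 0 then L - 1 else i - 1)"
  have k: "k < L" "Suc k mod L = i" using ij assms by (auto simp: k_def)
  have uniq: "m = k" if "m < L" "Suc m mod L = i" for m
  proof (cases "Suc m = L")
    case True thus ?thesis using that by (auto simp: k_def)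
  next
    case False hence "Suc m mod L = Suc m" using that by simp
    thus ?thesis using that by (auto simp: k_def)
  qed
  have "(matC L * transpose_mat (matC L)) $$ (i, j) =
      (\<Sum>m<L. (if i = Suc m mod L then 1 else 0) * (if j = Suc m mod L then 1 else 0 :: 'a))"
  proof -
    have "(matC L * transpose_mat (matC L)) $$ (i, j) = (\<Sum>m<L. matC L $$ (i, m) * (matC L $$ (j, m) :: 'a))"
      using ij by (simp add: times_mat_def scalar_prod_def lessThan_atLeast0 matC_carrier[THEN carrier_matD(1)] matC_carrier[THEN carrier_matD(2)])
    also have "\<dots> = (\<Sum>m<L. (if i = Suc m mod L then 1 else 0) * (if j = Suc m mod L then 1 else 0 :: 'a))"
      by (rule sum.cong[OF refl]) (use ij in \<open>simp only: lessThan_iff matC_def index_mat case_prod_conv Suc_eq_plus1\<close>)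
    finally show ?thesis .
  qed
  also have "\<dots> = (\<Sum>m<L. if m = k then (if j = i then 1 else 0) else 0)"
  proof (rule sum.cong[OF refl])
    fix m assume m: "m \<in> {..<L}"
    show "(if i = Suc m mod L then 1 else 0) * (if j = Suc m mod L then 1 else 0 :: 'a) =
        (if m = k then (if j = i then 1 else 0) else 0)"
    proof (cases "m = k")
      case True thus ?thesis using k(2) by (simp only: if_True mult_1_left simp_thms)
    next
      case False
      hence "Suc m mod L \<noteq> i" using uniq m by blast
      thus ?thesis using False by (simp only: if_False mult_zero_left simp_thms split: if_split) metis
    qed
  qed
  also have "\<dots> = 1\<^sub>m L $$ (i, j)" using k ij by auto
  finally show "(matC L * transpose_mat (matC L)) $$ (i, j) = (1\<^sub>m L :: 'a mat) $$ (i, j)" .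
qed (simp_all add: matC_def)

lemma matC_inverse:
  assumes "0 < L"
  shows "mat_inverse (matC L :: 'a :: field mat) = Some (transpose_mat (matC L))"
proof -
  let ?C = "matC L :: 'a mat"
  have C: "?C \<in> carrier_mat L L" "transpose_mat ?C \<in> carrier_mat L L" by (auto simp: transpose_carrier_mat)
  have r: "?C * transpose_mat ?C = 1\<^sub>m L" by (rule matC_transpose[OF assms])
  have l: "transpose_mat ?C * ?C = 1\<^sub>m L"
    by (rule mat_mult_left_right_inverse[OF C r])
  have "?C \<in> Units (ring_mat TYPE('a) L ())"
    using C r l by (auto simp: Units_def ring_mat_def)
  then obtain D where D: "mat_inverse ?C = Some D"
    using mat_inverse(1)[OF C(1), where b = "()"] by (cases "mat_inverse ?C") auto
  from mat_inverse(2)[OF C(1) D] have D': "?C * D = 1\<^sub>m L" "D * ?C = 1\<^sub>m L" "D \<in> carrier_mat L L" by auto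
  have "D = D * (?C * transpose_mat ?C)" using D' r by simp
  also have "\<dots> = (D * ?C) * transpose_mat ?C" by (rule assoc_mult_mat[symmetric, OF D'(3) C])
  also have "\<dots> = transpose_mat ?C" unfolding D'(2) by (rule left_mult_one_mat[OF C(2)])
  finally show ?thesis using D by simp
qed

lemma block_square:
  "block * block = (2 :: 'a :: field) \<cdot>\<^sub>m 1\<^sub>m 2"
proof (rule eq_matI)
  fix i j assume "i < dim_row ((2 :: 'a) \<cdot>\<^sub>m 1\<^sub>m 2)" "j < dim_col ((2 :: 'a) \<cdot>\<^sub>m 1\<^sub>m 2)"
  hence "i = 0 \<or> i = 1" "j = 0 \<or> j = 1" by auto
  thus "(block * block) $$ (i, j) = ((2 :: 'a) \<cdot>\<^sub>m 1\<^sub>m 2) $$ (i, j)"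
    by (elim disjE) (simp_all add: block_def mat_of_rows_list_def scalar_prod_def)
qed (simp_all add: block_def mat_of_rows_list_def)

lemma block_carrier [simp]: "block \<in> carrier_mat 2 2"
  by (rule carrier_matI) (simp_all add: block_def mat_of_rows_list_def)

lemma matA_carrier: "even L \<Longrightarrow> matA L \<in> carrier_mat L L"
  by (rule carrier_matI)
    (simp_all only: matA_def dim_diag_block_mat map_replicate sum_list_replicate
      carrier_matD[OF block_carrier] of_nat_id dvd_div_mult_self)

lemma matA_invertible:
  assumes "even L" and "(2 :: 'a :: {field, finite}) \<noteq> 0"
  obtains A' :: "'a :: {field, finite} mat" where "A' \<in> carrier_mat L L" "matA L * A' = 1\<^sub>m L"
proof -
  have A: "(matA L :: 'a mat) \<in> carrier_mat L L" using matA_carrier assms by blast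
  have "block * (inverse 2 \<cdot>\<^sub>m block) = inverse (2 :: 'a) \<cdot>\<^sub>m (block * block)"
    by (rule mult_smult_distrib[OF block_carrier block_carrier])
  also have "\<dots> = 1\<^sub>m 2" unfolding block_square using assms(2) by (intro eq_matI) simp_all
  finally have "\<exists>k\<ge>1. (block :: 'a mat) ^\<^sub>m k = 1\<^sub>m 2"
    by (rule pow_mat_finite_order[OF block_carrier smult_carrier_mat[OF block_carrier]])
  then obtain k where k: "k \<ge> 1" "(block :: 'a mat) ^\<^sub>m k = 1\<^sub>m 2" by blast
  have "(matA L :: 'a mat) ^\<^sub>m k = diag_block_mat (replicate (L div 2) (1\<^sub>m 2))"
    unfolding matA_def using carrier_matD[OF block_carrier[where 'a = 'a]]
    by (subst diag_block_pow_mat) (simp_all add: k)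
  also have "\<dots> = 1\<^sub>m L"
    using diag_block_one_mat[of "replicate (L div 2) (1\<^sub>m 2 :: 'a mat)"] assms(1)
    by (simp add: sum_list_replicate)
  finally have "(matA L :: 'a mat) ^\<^sub>m (k - 1) * matA L = 1\<^sub>m L"
    using k(1) by (cases k) auto
  from mat_mult_left_right_inverse[OF _ A this] A show ?thesis
    by (intro that[of "matA L ^\<^sub>m (k - 1)"]) auto
qed

lemma matV_pow_eq_one:
  assumes L: "even L" "0 < L" and two: "(2 :: 'a :: {field, finite}) \<noteq> 0"
  shows "\<exists>T\<ge>1. (matV L :: 'a :: {field, finite} mat) ^\<^sub>m T = 1\<^sub>m (dim_row (matV L :: 'a mat))"
proof -
  let ?A = "matA L :: 'a mat" and ?C = "matC L :: 'a mat" and ?D = "transpose_mat (matC L) :: 'a mat"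
  have A: "?A \<in> carrier_mat L L" by (rule matA_carrier[OF L(1)])
  have C: "?C \<in> carrier_mat L L" and D: "?D \<in> carrier_mat L L" by auto
  have CD: "?C * ?D = 1\<^sub>m L" by (rule matC_transpose[OF L(2)])
  have DC: "?D * ?C = 1\<^sub>m L" by (rule mat_mult_left_right_inverse[OF C D CD])
  obtain A' :: "'a mat" where A': "A' \<in> carrier_mat L L" and AA': "?A * A' = 1\<^sub>m L"
    using matA_invertible[OF L(1) two] by blast
  have cancel: "X * (Y * Z) = Z" if "X * Y = 1\<^sub>m L" "X \<in> carrier_mat L L"
      "Y \<in> carrier_mat L L" "Z \<in> carrier_mat L L" for X Y Z :: "'a mat"
    using that by (simp add: assoc_mult_mat[of X L L Y L Z L, symmetric])
  have V: "(matV L :: 'a mat) = ?A * (?C * (?A * ?D))"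
    unfolding matV_def matB_def matC_inverse[OF L(2)] option.sel
    using assoc_mult_mat[OF C A D] by simp
  define W where "W = ?C * (A' * (?D * A'))"
  have W: "W \<in> carrier_mat L L" using A' C D by (auto simp: W_def intro!: mult_carrier_mat)
  have c: "A' * (?D * A') \<in> carrier_mat L L" "?D * A' \<in> carrier_mat L L"
    "?A * ?D \<in> carrier_mat L L" "?C * (?A * ?D) \<in> carrier_mat L L"
    using A A' C D by (auto intro!: mult_carrier_mat)
  have "matV L * W = ?A * (?C * (?A * (?D * W)))"
    unfolding V assoc_mult_mat[OF A c(4) W] assoc_mult_mat[OF C c(3) W] assoc_mult_mat[OF A D W] ..
  also have "\<dots> = 1\<^sub>m L"
    unfolding W_def cancel[OF DC D C c(1)] cancel[OF AA' A A' c(2)] cancel[OF CD C D A'] by (rule AA')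
  finally have VW: "matV L * W = 1\<^sub>m L" .
  have Vc: "(matV L :: 'a mat) \<in> carrier_mat L L"
    unfolding V using A c by (auto intro!: mult_carrier_mat)
  from pow_mat_finite_order[OF Vc W VW] show ?thesis using Vc by auto
qed

lemma two_neq_zero_mod_ring:
  assumes "odd CARD('p :: prime_card)"
  shows "(2 :: 'p mod_ring) \<noteq> 0"
proof
  assume "(2 :: 'p mod_ring) = 0"
  hence "(of_nat 2 :: 'p mod_ring) = 0" by simp
  hence "CARD('p) dvd 2" by (simp only: of_nat_eq_0_iff_char_dvd semiring_char_mod_ring)
  hence "CARD('p) = 2"
    using prime_card[where 'a = 'p] primes_dvd_imp_eq two_is_prime_nat by blast
  thus False using assms by (metis even_numeral)
qed

corollary matV_pow_eq_one_mod_ring: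
  assumes "odd CARD('p :: prime_card)" "even L" "0 < L"
  shows "\<exists>T\<ge>1. (matV L :: 'p mod_ring mat) ^\<^sub>m T = 1\<^sub>m (dim_row (matV L :: 'p mod_ring mat))"
  using matV_pow_eq_one[OF assms(2,3) two_neq_zero_mod_ring[OF assms(1)]] .

end

(* Identify a vector of length L = 2l with an L-periodic sequence on the integers, and let S be the
   shift by two. Then V commutes with S and V^2 = (S + S^-1 - 2) V - 4. Hence every power of V has
   the form sum_j a(j) S^j + b(j) S^j V with coefficient sequences a, b that are l-periodic and even,
   so that they are determined by their values at 0, ..., l div 2. Multiplication by V is an
   injective linear map on these pairs (a, b), and the orbit of the pair representing the identity
   avoids 0, so it closes up after at most p^(2 (l div 2 + 1)) - 1 steps. For l >= 3 the exponent is
   at most 2l - 2, which suffices. For l = 2 the eigenspaces of S give V^2 = -4 and (V + 2)^2 = 0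
   respectively, so V^(2p(p-1)) = 1 by Fermat's little theorem. *)

theory Submission
  imports Defs "Berlekamp_Zassenhaus.Berlekamp_Type_Based"
begin

section \<open>Operators on integer sequences and their quadratic relation\<close>

text \<open>Indexing by all integers avoids reduction mod L; the parity of an index is its position
  inside its 2x2 block.\<close>

definition opA :: "(int \<Rightarrow> 'a) \<Rightarrow> int \<Rightarrow> 'a :: comm_ring_1" where
  "opA f i = (if even i then f i + f (i + 1) else f (i - 1) - f i)"

text \<open>The action of \<open>V = A C A C\<^sup>-\<^sup>1\<close>, where \<open>C\<close> acts by \<open>f \<mapsto> (\<lambda>i. f (i - 1))\<close>.\<close>

definition opV :: "(int \<Rightarrow> 'a) \<Rightarrow> int \<Rightarrow> 'a :: comm_ring_1" where
  "opV f = opA (\<lambda>i. opA (\<lambda>k. f (k + 1)) (i - 1))"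

lemma opV_even: "even i \<Longrightarrow> opV f i = f (i - 1) - f i + f (i + 1) + f (i + 2)"
  and opV_odd: "odd i \<Longrightarrow> opV f i = f (i - 2) - f (i - 1) - f i - f (i + 1)"
  by (simp_all add: opV_def opA_def algebra_simps)

text \<open>Cayley-Hamilton: on the pair of even-indexed and odd-indexed entries, V is a 2x2 matrix
  of Laurent polynomials in S with trace \<open>S + S^-1 - 2\<close> and determinant 4.\<close>

lemma opV_square: "opV (opV f) i = opV f (i - 2) + opV f (i + 2) - 2 * opV f i - 4 * f i"
  by (cases "even i") (simp_all add: opV_even opV_odd algebra_simps)

lemma opV_shift: "opV f (i + 2 * j) = opV (\<lambda>k. f (k + 2 * j)) i"
  by (cases "even i") (simp_all add: opV_even opV_odd algebra_simps)

lemma opV_add: "opV (\<lambda>i. f i + g i) = (\<lambda>i. opV f i + opV g i)"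
proof
  show "opV (\<lambda>i. f i + g i) i = opV f i + opV g i" for i
    by (cases "even i") (simp_all add: opV_even opV_odd algebra_simps)
qed

lemma opV_scale: "opV (\<lambda>i. c * f i) = (\<lambda>i. c * opV f i)"
proof
  show "opV (\<lambda>i. c * f i) i = c * opV f i" for i
    by (cases "even i") (simp_all add: opV_even opV_odd algebra_simps)
qed

lemma funpow_opV_add: "(opV ^^ k) (\<lambda>i. f i + g i) = (\<lambda>i. (opV ^^ k) f i + (opV ^^ k) g i)"
  by (induction k) (simp_all add: opV_add)

lemma funpow_opV_scale: "(opV ^^ k) (\<lambda>i. c * f i) = (\<lambda>i. c * (opV ^^ k) f i)"
  by (induction k) (simp_all add: opV_scale)

section \<open>Periodic sequences\<close>

definition periodic :: "nat \<Rightarrow> (int \<Rightarrow> 'a) \<Rightarrow> bool" where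
  "periodic n f \<longleftrightarrow> (\<forall>i. f (i + int n) = f i)"

lemma periodic_mult:
  assumes "periodic n f"
  shows "f (i + int n * k) = f i"
proof (induction k rule: int_induct[where k = 0])
  case (step1 k)
  have "f (i + int n * (k + 1)) = f (i + int n * k + int n)" by (simp add: algebra_simps)
  then show ?case using step1 assms by (simp add: periodic_def)
next
  case (step2 k)
  have "f (i + int n * (k - 1)) = f (i + int n * (k - 1) + int n)"
    using assms by (simp add: periodic_def)
  then show ?case using step2 by (simp add: algebra_simps)
qed simp

lemma periodic_mod: "periodic n f \<Longrightarrow> f (i mod int n) = f i"
  using periodic_mult[of n f "i mod int n" "i div int n"] by simp

lemma periodic_opV:
  assumes "periodic (2 * l) f"
  shows "periodic (2 * l) (opV f)"
  using assms opV_shift[of f _ "int l"] by (simp add: periodic_def)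

text \<open>Cyclic reindexing, which lets \<open>apply_step\<close> move a shift from the operand to
  the coefficients.\<close>

lemma sum_periodic_shift:
  fixes h :: "int \<Rightarrow> 'a :: comm_monoid_add"
  assumes "periodic l h"
  shows "(\<Sum>j<l. h (int j + 1)) = (\<Sum>j<l. h (int j))"
proof (cases l)
  case (Suc n)
  have "(\<Sum>j<l. h (int j + 1)) = (\<Sum>j<n. h (int (Suc j))) + h (0 + int l)"
    by (simp add: Suc add.commute)
  also have "h (0 + int l) = h (int 0)"
    using assms by (simp only: periodic_def) simp
  finally show ?thesis by (simp only: Suc sum.lessThan_Suc_shift) (simp add: add.commute)
qed simp

section \<open>Operators coded by pairs of coefficient sequences\<close>

text \<open>A pair \<open>(a, b)\<close> stands for the operator \<open>\<Sum>j. a j S\<^sup>j + b j S\<^sup>j V\<close>, with \<open>S\<close> the shift by two;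
  \<open>step\<close> is composition with \<open>V\<close>, computed by \<open>V\<^sup>2 = (S + S\<^sup>-\<^sup>1 - 2) V - 4\<close>.\<close>

definition step :: "(int \<Rightarrow> 'a) \<times> (int \<Rightarrow> 'a) \<Rightarrow> (int \<Rightarrow> 'a) \<times> (int \<Rightarrow> 'a :: comm_ring_1)" where
  "step = (\<lambda>(a, b). (\<lambda>j. - 4 * b j, \<lambda>j. a j + b (j - 1) + b (j + 1) - 2 * b j))"

text \<open>Here \<open>S^j\<close> sends f to the sequence with entries
  \<open>f (i - 2 * j)\<close>. One period of j suffices, since \<open>S^l\<close> is the identity
  on sequences of period 2l.\<close>

definition apply_state ::
    "nat \<Rightarrow> (int \<Rightarrow> 'a) \<times> (int \<Rightarrow> 'a) \<Rightarrow> (int \<Rightarrow> 'a) \<Rightarrow> int \<Rightarrow> 'a :: comm_ring_1" where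
  "apply_state l s f i =
    (\<Sum>j<l. fst s (int j) * f (i - 2 * int j) + snd s (int j) * opV f (i - 2 * int j))"

text \<open>Evenness reflects the symmetry of \<open>S + S^-1\<close>. It roughly halves the number
  of free values, which is 2l under periodicity alone.\<close>

definition states :: "nat \<Rightarrow> ((int \<Rightarrow> 'a) \<times> (int \<Rightarrow> 'a)) set" where
  "states l = {(a, b). periodic l a \<and> periodic l b \<and> (\<forall>j. a (- j) = a j) \<and> (\<forall>j. b (- j) = b j)}"

lemma step_states: "s \<in> states l \<Longrightarrow> step s \<in> states l"
proof -
  assume s: "s \<in> states l"
  obtain a b where ab: "s = (a, b)" by (cases s)
  have p: "periodic l a" "periodic l b" and e: "\<And>j. a (- j) = a j" "\<And>j. b (- j) = b j"
    using s by (auto simp: states_def ab)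
  have "b (j - 1 + int l) = b (j - 1)" "b (j + 1 + int l) = b (j + 1)" for j
    using p by (auto simp: periodic_def)
  moreover have "b (- j - 1) = b (j + 1)" "b (- j + 1) = b (j - 1)" for j
    using e(2)[of "j + 1"] e(2)[of "j - 1"] by simp_all
  ultimately show ?thesis
    using p e by (simp add: states_def step_def ab periodic_def algebra_simps)
qed

text \<open>As 4 is invertible, the first component of the image determines b, and then the second
  determines a.\<close>

lemma inj_step:
  assumes "(4 :: 'a :: field) \<noteq> 0"
  shows "inj (step :: _ \<Rightarrow> _ \<times> (int \<Rightarrow> 'a))"
proof (rule injI)
  fix s t :: "(int \<Rightarrow> 'a) \<times> (int \<Rightarrow> 'a)"
  assume eq: "step s = step t"
  obtain a b c d where st: "s = (a, b)" "t = (c, d)" by (cases s, cases t)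
  have "b j = d j" for j
    using arg_cong[OF eq, of "\<lambda>s. fst s j"] assms by (simp add: step_def st)
  then have "b = d" by blast
  moreover have "a j = c j" for j
    using arg_cong[OF eq, of "\<lambda>s. snd s j"] \<open>b = d\<close> by (simp add: step_def st)
  ultimately show "s = t" using st by blast
qed

text \<open>The relation for \<open>V^2\<close> pairs b with shifted values of V f; summing over a
  full period turns these into shifted values of b, which are the coefficients in
  \<open>step\<close>.\<close>

lemma apply_step:
  assumes s: "s \<in> states l" and f: "periodic (2 * l) f"
  shows "apply_state l (step s) f i = apply_state l s (opV f) i"
proof -
  obtain a b where ab: "s = (a, b)" by (cases s)
  have b: "periodic l b" using s by (auto simp: states_def ab)
  define g where "g j = opV f (i - 2 * j)" for j
  \<comment> \<open>Raising j by l moves the argument by the full period 2l.\<close>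
  have g: "periodic l g"
    using periodic_mult[OF periodic_opV[OF f], of "i - 2 * j" "- 1" for j]
    by (simp add: g_def periodic_def right_diff_distrib' distrib_left diff_diff_eq)
  have "periodic l (\<lambda>j. b (j + c) * g (j + d))" for c d
    using b g by (simp add: periodic_def add.assoc add.commute[of "int l"])
      (simp flip: add.assoc)
  from this[of "- 1" 0] this[of 0 "- 1"] have
    per: "periodic l (\<lambda>j. b (j - 1) * g j)" "periodic l (\<lambda>j. b j * g (j - 1))" by simp_all
  have 1: "(\<Sum>j<l. b (int j) * g (int j + 1)) = (\<Sum>j<l. b (int j - 1) * g (int j))"
    using sum_periodic_shift[OF per(1)] by simp
  have 2: "(\<Sum>j<l. b (int j) * g (int j - 1)) = (\<Sum>j<l. b (int j + 1) * g (int j))"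
    using sum_periodic_shift[OF per(2)] by simp
  have V: "opV (opV f) (i - 2 * j) = g (j + 1) + g (j - 1) - 2 * g j - 4 * f (i - 2 * j)" for j
    by (simp add: opV_square g_def algebra_simps)
  have "apply_state l s (opV f) i = (\<Sum>j<l. a (int j) * g (int j) - 2 * (b (int j) * g (int j))
      - 4 * b (int j) * f (i - 2 * int j))
      + (\<Sum>j<l. b (int j) * g (int j + 1)) + (\<Sum>j<l. b (int j) * g (int j - 1))"
    unfolding apply_state_def sum.distrib[symmetric] V g_def[symmetric]
    by (intro sum.cong refl) (simp add: ab algebra_simps)
  also have "\<dots> = apply_state l (step s) f i"
    unfolding 1 2 apply_state_def sum.distrib[symmetric] g_def[symmetric]
    by (intro sum.cong refl) (simp add: ab step_def algebra_simps)
  finally show ?thesis ..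
qed

text \<open>The pair coding the identity operator; testing divisibility by l rather than j = 0 makes
  the delta sequence l-periodic.\<close>

definition unit_state :: "nat \<Rightarrow> (int \<Rightarrow> 'a) \<times> (int \<Rightarrow> 'a :: comm_ring_1)" where
  "unit_state l = (\<lambda>j. if int l dvd j then 1 else 0, \<lambda>j. 0)"

lemma unit_state: "unit_state l \<in> states l" "unit_state l \<noteq> (\<lambda>j. 0, \<lambda>j. 0)"
  by (auto simp: unit_state_def states_def periodic_def dest: fun_cong[where x = 0])

lemma apply_unit_state: "0 < l \<Longrightarrow> apply_state l (unit_state l) f = f"
proof
  fix i
  assume l: "0 < l"
  have "apply_state l (unit_state l) f i = (\<Sum>j<l. if j = 0 then f i else 0)"
    unfolding apply_state_def
    by (rule sum.cong) (auto simp: unit_state_def dest: nat_dvd_not_less)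
  then show "apply_state l (unit_state l) f i = f i" using l by simp
qed

lemma funpow_step_states: "s \<in> states l \<Longrightarrow> (step ^^ k) s \<in> states l"
  by (induction k) (auto intro: step_states)

lemma apply_funpow_step:
  assumes "s \<in> states l" "periodic (2 * l) f"
  shows "apply_state l ((step ^^ k) s) f = apply_state l s ((opV ^^ k) f)"
  using assms(2)
\<comment> \<open>Each \<open>step\<close> becomes one \<open>opV\<close> on the operand, so f has
  to vary in the induction.\<close>
proof (induction k arbitrary: f)
  case (Suc k)
  show ?case
  proof
    fix i
    have "apply_state l ((step ^^ Suc k) s) f i = apply_state l ((step ^^ k) s) (opV f) i"
      using apply_step[OF funpow_step_states[OF assms(1)] Suc.prems] by simp
    also have "\<dots> = apply_state l s ((opV ^^ k) (opV f)) i"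
      using Suc.IH[OF periodic_opV[OF Suc.prems]] by (rule fun_cong)
    finally show "apply_state l ((step ^^ Suc k) s) f i = apply_state l s ((opV ^^ Suc k) f) i"
      by (simp only: funpow_Suc_right comp_apply)
  qed
qed simp

section \<open>Counting the pairs and closing the orbit\<close>

text \<open>The values at r and l - r agree, and one of these two indices is at most
  \<open>l div 2\<close>.\<close>

lemma even_periodic_eqI:
  assumes "periodic l a" "periodic l b" "\<And>j. a (- j) = a j" "\<And>j. b (- j) = b j"
    and l: "0 < l" and eq: "\<And>j. j \<le> l div 2 \<Longrightarrow> a (int j) = b (int j)"
  shows "a = b"
proof
  fix i
  define r where "r = nat (i mod int l)"
  have r: "int r = i mod int l" "r < l" using l by (simp_all add: r_def nat_less_iff)
  have i: "a i = a (int r)" "b i = b (int r)" using assms(1,2) by (simp_all add: r(1) periodic_mod)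
  show "a i = b i"
  proof (cases "r \<le> l div 2")
    case False
    have "c (int r) = c (int (l - r))" if "periodic l c" "\<And>j. c (- j) = c j" for c :: "int \<Rightarrow> 'a"
    proof -
      have "c (int r) = c (- int r)" using that(2) by simp
      also have "\<dots> = c (- int r + int l)" using that(1) by (simp only: periodic_def)
      also have "- int r + int l = int (l - r)" using r(2) by simp
      finally show ?thesis .
    qed
    from this[of a] this[of b] show ?thesis using assms(1-4) eq[of "l - r"] False by (simp add: i)
  qed (simp add: i eq)
qed

lemma card_states:
  assumes "0 < l"
  shows "finite (states l :: (_ \<times> (int \<Rightarrow> 'a :: finite)) set)"
    "card (states l :: (_ \<times> (int \<Rightarrow> 'a)) set) \<le> CARD('a) ^ (2 * (l div 2 + 1))"
proof -
  \<comment> \<open>The number of indices 0, ..., \<open>l div 2\<close> at which each sequence is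
    read off.\<close>
  define m where "m = l div 2 + 1"
  define code :: "(int \<Rightarrow> 'a) \<times> (int \<Rightarrow> 'a) \<Rightarrow> 'a list" where
    "code = (\<lambda>(a, b). map (\<lambda>j. a (int j)) [0..<m] @ map (\<lambda>j. b (int j)) [0..<m])"
  have inj: "inj_on code (states l)"
  proof (rule inj_onI)
    fix s t assume s: "s \<in> states l" and t: "t \<in> states l" and eq: "code s = code t"
    obtain a b c d where st: "s = (a, b)" "t = (c, d)" by (cases s, cases t)
    have "a (int j) = c (int j)" "b (int j) = d (int j)" if "j \<le> l div 2" for j
      using eq that by (auto simp: code_def st m_def)
    then show "s = t" using s t even_periodic_eqI[OF _ _ _ _ assms, of a c]
        even_periodic_eqI[OF _ _ _ _ assms, of b d] by (auto simp: states_def st)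
  qed
  let ?Y = "{xs :: 'a list. set xs \<subseteq> UNIV \<and> length xs = 2 * m}"
  have sub: "code ` states l \<subseteq> ?Y" by (auto simp: code_def)
  have fin: "finite ?Y" by (rule finite_lists_length_eq) simp
  show "finite (states l :: (_ \<times> (int \<Rightarrow> 'a)) set)"
    using inj sub fin by (rule inj_on_finite)
  have "card (states l :: (_ \<times> (int \<Rightarrow> 'a)) set) \<le> card ?Y"
    using inj sub fin by (rule card_inj_on_le)
  also have "card ?Y = CARD('a) ^ (2 * m)" by (rule card_lists_length_eq) simp
  finally show "card (states l :: (_ \<times> (int \<Rightarrow> 'a)) set) \<le> CARD('a) ^ (2 * (l div 2 + 1))"
    by (simp only: m_def)
qed

text \<open>Pigeonhole on the \<open>card X + 1\<close> iterates with exponents 0, ...,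
  \<open>card X\<close>; injectivity cancels the common initial iterates.\<close>

lemma funpow_return:
  assumes "finite X" "f ` X \<subseteq> X" "inj f" "x \<in> X"
  obtains T where "1 \<le> T" "T \<le> card X" "(f ^^ T) x = x"
proof -
  have mem: "(f ^^ k) x \<in> X" for k
    using assms(2,4) by (induction k) auto
  have "\<not> inj_on (\<lambda>k. (f ^^ k) x) {..card X}"
  proof
    assume "inj_on (\<lambda>k. (f ^^ k) x) {..card X}"
    then have "card {..card X} \<le> card X"
      using mem assms(1) by (intro card_inj_on_le[where f = "\<lambda>k. (f ^^ k) x"]) auto
    then show False by simp
  qed
  then obtain i j where ij: "i < j" "j \<le> card X" "(f ^^ i) x = (f ^^ j) x"
    unfolding inj_on_def by (metis atMost_iff nat_neq_iff)
  have "(f ^^ i) ((f ^^ (j - i)) x) = (f ^^ i) x"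
    using ij by (simp flip: funpow_add[THEN fun_cong, unfolded comp_apply])
  then have "(f ^^ (j - i)) x = x"
    using inj_fn[OF assms(3)] by (auto dest: injD)
  with ij show ?thesis by (intro that[of "j - i"]) auto
qed

text \<open>Once the pair of the identity returns to itself, \<open>V^T\<close> is the identity
  operator, so a single T serves all f.\<close>

lemma opV_return:
  assumes four: "(4 :: 'a :: {field, finite}) \<noteq> 0" and l: "0 < l"
  obtains T where "1 \<le> T" "T \<le> CARD('a) ^ (2 * (l div 2 + 1)) - 1"
    "\<And>f :: int \<Rightarrow> 'a. periodic (2 * l) f \<Longrightarrow> (opV ^^ T) f = f"
proof -
  let ?z = "(\<lambda>j. 0, \<lambda>j. 0) :: (int \<Rightarrow> 'a) \<times> (int \<Rightarrow> 'a)"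
  let ?X = "states l - {?z}"
  have z: "?z \<in> states l" by (simp add: states_def periodic_def)
  have inj: "inj (step :: _ \<Rightarrow> _ \<times> (int \<Rightarrow> 'a))" by (rule inj_step[OF four])
  \<comment> \<open>Zero is a fixed point of an injective map, so nothing else maps to it;
    discarding it saves 1 in the bound.\<close>
  have "step ?z = ?z" by (simp add: step_def)
  then have "step s \<noteq> ?z" if "s \<noteq> ?z" for s
    using injD[OF inj, of s ?z] that by auto
  then have "step s \<in> ?X" if "s \<in> ?X" for s
    using that step_states[of s l] by (simp only: Diff_iff singleton_iff simp_thms)
  then have sub: "step ` ?X \<subseteq> ?X" by (rule image_subsetI)
  have fin: "finite ?X" using card_states(1)[OF l] by (rule finite_Diff)
  have unit: "unit_state l \<in> ?X" using unit_state by (intro DiffI) simp_all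
  obtain T where T: "1 \<le> T" "T \<le> card ?X" "(step ^^ T) (unit_state l) = (unit_state l :: _ \<times> (int \<Rightarrow> 'a))"
    using funpow_return[OF fin sub inj unit] .
  have "card ?X \<le> CARD('a) ^ (2 * (l div 2 + 1)) - 1"
    using card_states[OF l, where 'a = 'a] z by (simp add: card_Diff_singleton diff_le_mono)
  moreover have "(opV ^^ T) f = f" if "periodic (2 * l) f" for f :: "int \<Rightarrow> 'a"
    using apply_funpow_step[OF unit_state(1) that, of T] l by (simp add: T apply_unit_state)
  ultimately show ?thesis using that[OF T(1) le_trans[OF T(2)]] by blast
qed

section \<open>The case l = 2: eigenspaces of the shift\<close>

text \<open>For S = 1 the linear term of the quadratic relation vanishes, leaving
  \<open>V^2 = - 4\<close>.\<close>

lemma funpow_opV_invariant: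
  fixes f :: "int \<Rightarrow> 'a :: comm_ring_1"
  assumes "\<And>i. f (i + 2) = f i"
  shows "(opV ^^ (2 * n)) f = (\<lambda>i. (- 4) ^ n * f i)"
proof (induction n)
  case (Suc n)
  have "opV f (i + 2) = opV f i" for i
    using opV_shift[of f i 1] assms by simp
  from this this[of "_ - 2"] have "opV (opV f) = (\<lambda>i. - 4 * f i)"
    by (intro ext) (simp add: opV_square)
  then show ?case
    by (simp add: Suc opV_scale) (simp add: algebra_simps)
qed simp

text \<open>For S = -1 the relation reads \<open>(V + 2)^2 = 0\<close>, so
  \<open>V = - 2 + N\<close> with N of square zero, and the binomial expansion stops at the linear
  term. Doubling avoids a division by 2.\<close>

lemma funpow_opV_antiinvariant:
  fixes f :: "int \<Rightarrow> 'a :: comm_ring_1"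
  assumes "\<And>i. f (i + 2) = - f i"
  shows "2 * (opV ^^ k) f i = (- 2) ^ k * (2 * (1 - of_nat k) * f i - of_nat k * opV f i)"
proof (induction k arbitrary: i)
  case (Suc k)
  have sh: "opV f (i + 2) = - opV f i" for i
    using opV_shift[of f i 1] opV_scale[of "- 1" f] assms by simp
  have sh': "opV f (i - 2) = - opV f i" for i
    using sh[of "i - 2"] by simp
  have sq: "opV (opV f) i = - 4 * opV f i - 4 * f i" for i
    by (simp add: opV_square sh sh')
  have "2 * (opV ^^ Suc k) f i = opV (\<lambda>i. 2 * (opV ^^ k) f i) i"
    by (simp add: opV_scale)
  also have "\<dots> = opV (\<lambda>i. ((- 2) ^ k * (2 * (1 - of_nat k))) * f i
      + (- ((- 2) ^ k * of_nat k)) * opV f i) i"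
    unfolding Suc.IH by (simp add: algebra_simps)
  also have "\<dots> = ((- 2) ^ k * (2 * (1 - of_nat k))) * opV f i
      + (- ((- 2) ^ k * of_nat k)) * (- 4 * opV f i - 4 * f i)"
    unfolding opV_add opV_scale sq ..
  also have "\<dots> = (- 2) ^ Suc k * (2 * (1 - of_nat (Suc k)) * f i - of_nat (Suc k) * opV f i)"
    by (simp add: algebra_simps)
  finally show ?case .
qed simp

lemma opV_return_4:
  fixes f :: "int \<Rightarrow> 'p :: prime_card mod_ring"
  assumes odd: "odd CARD('p)" and f: "periodic 4 f"
  shows "(opV ^^ (2 * (CARD('p) * (CARD('p) - 1)))) f = f"
proof
  fix i :: int
  \<comment> \<open>In the exponent, 2 brings in \<open>V^2 = - 4\<close>, p kills the nilpotent
    term, and p - 1 serves Fermat's theorem.\<close>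
  let ?p = "CARD('p)" and ?k = "2 * (CARD('p) * (CARD('p) - 1))"
  \<comment> \<open>Since \<open>S^2 = 1\<close> on sequences of period 4, these are the components
    of 2 f in the eigenspaces S = 1 and S = -1.\<close>
  let ?g = "\<lambda>i. f i + f (i + 2)" and ?h = "\<lambda>i. f i + (- 1) * f (i + 2)"
  have f4: "f (i + 2 + 2) = f i" for i using f by (simp add: periodic_def add.assoc)
  have two: "(2 :: 'p mod_ring) \<noteq> 0" by (rule two_neq_zero_mod_ring[OF odd])
  have fermat: "c ^ (?p * (?p - 1)) = 1" if "c \<noteq> 0" for c :: "'p mod_ring"
  proof -
    have "c * c ^ (?p - 1) = c" 
      using fermat_theorem_mod_ring[of c] by (simp flip: power_Suc)
    then have "c ^ (?p - 1) = 1" using that by simp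
    then show ?thesis by (simp add: mult.commute[of ?p] power_mult)
  qed
  have "(- 4 :: 'p mod_ring) = - (2 * 2)" by simp
  then have four: "(- 4 :: 'p mod_ring) \<noteq> 0" using two by (simp only: neg_equal_0_iff_equal mult_eq_0_iff simp_thms)
  have k: "of_nat ?k = (0 :: 'p mod_ring)"
    using of_nat_eq_0_iff_char_dvd[where 'a = "'p mod_ring", of ?k] 
    by (simp add: semiring_char_mod_ring)
  have g: "(opV ^^ ?k) ?g i = ?g i"
    by (subst funpow_opV_invariant) (simp_all only: f4 fermat[OF four] mult_1_left, rule add.commute)
  have "(- 2 :: 'p mod_ring) ^ ?k = ((- 2) ^ (?p * (?p - 1)))\<^sup>2"
    by (simp only: mult.commute[of 2] power_mult)
  also have "\<dots> = 1" using fermat[of "- 2"] two by simp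
  finally have k2: "(- 2 :: 'p mod_ring) ^ ?k = 1" .
  have "2 * (opV ^^ ?k) ?h i = (- 2) ^ ?k * (2 * (1 - of_nat ?k) * ?h i - of_nat ?k * opV ?h i)"
    by (rule funpow_opV_antiinvariant) (simp only: f4, simp)
  then have "2 * (opV ^^ ?k) ?h i = 2 * ?h i"
    unfolding k k2 by (simp only: mult_1_left mult_zero_left diff_zero mult_1_right)
  then have h: "(opV ^^ ?k) ?h i = ?h i" using two by (simp only: mult_cancel_left simp_thms)
  have "2 * (opV ^^ ?k) f i = (opV ^^ ?k) (\<lambda>i. 2 * f i) i" by (simp only: funpow_opV_scale)
  also have "(\<lambda>i. 2 * f i) = (\<lambda>i. ?g i + ?h i)" by auto
  also have "(opV ^^ ?k) \<dots> i = ?g i + ?h i" unfolding funpow_opV_add[of _ ?g ?h] g h ..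
  also have "\<dots> = 2 * f i" by simp
  finally show "(opV ^^ ?k) f i = f i" using two by simp
qed

section \<open>From matrices acting on vectors to operators on sequences\<close>

definition extend :: "'a vec \<Rightarrow> int \<Rightarrow> 'a" where
  "extend v i = v $ nat (i mod int (dim_vec v))"

lemma periodic_extend: "periodic (dim_vec v) (extend v)"
  by (simp add: periodic_def extend_def)

text \<open>The induction splits off the first diagonal block; the remaining indices drop by 2,
  which keeps their parity and lowers their halves by 1.\<close>

lemma matA_index:
  "i < 2 * n \<Longrightarrow> j < 2 * n \<Longrightarrow>
    matA (2 * n) $$ (i, j) = (if i div 2 = j div 2 then if odd i \<and> odd j then - 1 else 1 else 0)"
proof (induction n arbitrary: i j)
  case (Suc n)
  have eq: "matA (2 * Suc n) = four_block_mat block (0\<^sub>m 2 (2 * n)) (0\<^sub>m (2 * n) 2) (matA (2 * n) :: 'a mat)"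
    using carrier_matD[OF block_carrier[where 'a = 'a]] 
      carrier_matD[OF matA_carrier[of "2 * n", where 'a = 'a]]
    by (simp add: matA_def Let_def)
  have lt: "k < 2 \<longleftrightarrow> k = 0 \<or> k = 1" for k :: nat by auto
  have block: "block $$ (a, b) = (if a = 1 \<and> b = 1 then - 1 else 1 :: 'a)" if "a < 2" "b < 2" for a b
    using that by (auto simp: lt block_def mat_of_rows_list_def)
  have sub: "(k - 2) div 2 = k div 2 - 1" "even (k - 2) = even k" "1 \<le> k div 2" if "\<not> k < 2" for k :: nat
    using that by auto
  have low: "k div 2 = 0" "odd k \<longleftrightarrow> k = 1" if "k < 2" for k :: nat
    using that by (auto simp: lt)
  have dims: "dim_row (block :: 'a mat) = 2" "dim_col (block :: 'a mat) = 2"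
    "dim_row (matA (2 * n) :: 'a mat) = 2 * n" "dim_col (matA (2 * n) :: 'a mat) = 2 * n"
    using carrier_matD[OF block_carrier[where 'a = 'a]]
      carrier_matD[OF matA_carrier[of "2 * n", where 'a = 'a]] by simp_all
  show ?case
  proof (cases "i < 2")
    case True
    then show ?thesis unfolding eq using Suc.prems sub(3)[of j]
      by (cases "j < 2") (simp_all add: dims block low)
  next
    case False
    have "i div 2 - 1 = j div 2 - 1 \<longleftrightarrow> i div 2 = j div 2" if "\<not> j < 2"
      using sub(3)[OF False] sub(3)[OF that] by linarith
    then show ?thesis unfolding eq using Suc.prems False sub(3)[of i]
      by (cases "j < 2") (simp_all add: dims low Suc.IH sub)
  qed
qed simp

lemma mult_mat_vec_index:
  assumes "M \<in> carrier_mat n m" "v \<in> carrier_vec m" "i < n"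
  shows "(M *\<^sub>v v) $ i = (\<Sum>j<m. M $$ (i, j) * v $ j)"
  using assms by (simp add: scalar_prod_def lessThan_atLeast0)

lemma periodic_eqI:
  assumes "periodic n f" "periodic n g" "0 < n" "\<And>i. i < n \<Longrightarrow> f (int i) = g (int i)"
  shows "f = g"
proof
  fix k
  have "f (k mod int n) = g (k mod int n)"
    using assms(4)[of "nat (k mod int n)"] assms(3) by (simp add: nat_less_iff)
  then show "f k = g k" using assms(1,2) by (simp add: periodic_mod)
qed

lemma extend_of_nat: "extend v (int j) = v $ (j mod dim_vec v)"
  by (simp add: extend_def flip: zmod_int)

text \<open>Row i meets only the two columns of its own block, so cyclic wraparound never
  enters.\<close>

lemma extend_matA:
  fixes v :: "'a :: field vec"
  assumes v: "v \<in> carrier_vec (2 * l)" and l: "0 < l"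
  shows "extend (matA (2 * l) *\<^sub>v v) = opA (extend v)"
proof (rule periodic_eqI[of "2 * l"])
  have A: "(matA (2 * l) :: 'a mat) \<in> carrier_mat (2 * l) (2 * l)" by (rule matA_carrier) simp
  have d: "dim_vec v = 2 * l" "dim_vec (matA (2 * l) *\<^sub>v v) = 2 * l" using v A by auto
  show "periodic (2 * l) (extend (matA (2 * l) *\<^sub>v v))"
    using periodic_extend[of "matA (2 * l) *\<^sub>v v"] unfolding d .
  show "periodic (2 * l) (opA (extend v))"
    using periodic_extend[of v] unfolding d periodic_def opA_def
    by (auto simp: algebra_simps) (simp_all flip: add.assoc diff_add_eq)
  fix i assume i: "i < 2 * l"
  define m where "m = i div 2"
  have m: "m < l" using i by (simp add: m_def)
  have "extend (matA (2 * l) *\<^sub>v v) (int i) = (\<Sum>j<2 * l. matA (2 * l) $$ (i, j) * v $ j)"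
    using i mult_mat_vec_index[OF A v i] by (simp only: extend_of_nat d mod_less)
  \<comment> \<open>All columns outside block m contribute zero.\<close>
  also have "\<dots> = (\<Sum>j\<in>{2 * m, 2 * m + 1}. matA (2 * l) $$ (i, j) * v $ j)"
    using i m by (intro sum.mono_neutral_right) (auto simp: matA_index m_def)
  also have "\<dots> = v $ (2 * m) + (if odd i then - 1 else 1) * v $ (2 * m + 1)"
    using i m by (simp add: matA_index) (simp add: m_def)
  also have "\<dots> = opA (extend v) (int i)"
  proof (cases "even i")
    case True
    then have "i = 2 * m" by (simp add: m_def)
    then show ?thesis using m extend_of_nat[of v "2 * m"] extend_of_nat[of v "2 * m + 1"]
      by (simp add: opA_def d add.commute)
  next
    case False
    then have "i = 2 * m + 1" unfolding m_def by presburger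
    then show ?thesis using m extend_of_nat[of v "2 * m"] extend_of_nat[of v "2 * m + 1"]
      by (simp add: opA_def d add.commute)
  qed
  finally show "extend (matA (2 * l) *\<^sub>v v) (int i) = opA (extend v) (int i)" .
qed (use l in simp)

lemma extend_transpose_matC:
  fixes v :: "'a :: field vec"
  assumes v: "v \<in> carrier_vec n" and n: "0 < n"
  shows "extend (transpose_mat (matC n) *\<^sub>v v) = (\<lambda>i. extend v (i + 1))"
proof (rule periodic_eqI[of n])
  let ?D = "transpose_mat (matC n) :: 'a mat"
  have D: "?D \<in> carrier_mat n n" by simp
  have d: "dim_vec v = n" "dim_vec (?D *\<^sub>v v) = n"
    using v mult_mat_vec_carrier[OF D v] by (simp_all only: carrier_vecD)
  show "periodic n (extend (?D *\<^sub>v v))"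
    using periodic_extend[of "?D *\<^sub>v v"] unfolding d .
  show "periodic n (\<lambda>i. extend v (i + 1))"
    using periodic_extend[of v] unfolding d periodic_def
    by (metis add.assoc add.commute)
  fix i assume i: "i < n"
  have "extend (?D *\<^sub>v v) (int i) = (\<Sum>j<n. ?D $$ (i, j) * v $ j)"
    using i mult_mat_vec_index[OF D v i] by (simp only: extend_of_nat d mod_less)
  also have "\<dots> = (\<Sum>j<n. if j = (i + 1) mod n then v $ j else 0)"
    using i by (intro sum.cong) (auto simp: matC_def)
  also have "\<dots> = v $ ((i + 1) mod n)" using n by simp
  also have "\<dots> = extend v (int i + 1)" using extend_of_nat[of v "i + 1"] by (simp add: d add.commute)
  finally show "extend (?D *\<^sub>v v) (int i) = extend v (int i + 1)" .
qed (fact n)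

text \<open>Inverts the shift of the previous lemma, because the transpose of C is its
  inverse.\<close>

lemma extend_matC:
  fixes v :: "'a :: field vec"
  assumes v: "v \<in> carrier_vec n" and n: "0 < n"
  shows "extend (matC n *\<^sub>v v) = (\<lambda>i. extend v (i - 1))"
proof -
  let ?C = "matC n :: 'a mat" and ?D = "transpose_mat (matC n) :: 'a mat"
  have CD: "?C \<in> carrier_mat n n" "?D \<in> carrier_mat n n" by simp_all
  have "?D *\<^sub>v (?C *\<^sub>v v) = v"
    using mat_mult_left_right_inverse[OF CD matC_transpose[OF n]] v
    by (simp flip: assoc_mult_mat_vec[OF CD(2,1) v])
  then have "extend v = (\<lambda>i. extend (?C *\<^sub>v v) (i + 1))"
    using extend_transpose_matC[OF mult_mat_vec_carrier[OF CD(1) v] n] by simp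
  then show ?thesis by simp
qed

lemma
  assumes "0 < l"
  shows matV_carrier: "(matV (2 * l) :: 'a :: field mat) \<in> carrier_mat (2 * l) (2 * l)"
    and extend_matV: "v \<in> carrier_vec (2 * l) \<Longrightarrow>
      extend (matV (2 * l) *\<^sub>v v) = opV (extend (v :: 'a vec))"
proof -
  let ?n = "2 * l"
  let ?A = "matA ?n :: 'a mat" and ?C = "matC ?n :: 'a mat" and ?D = "transpose_mat (matC ?n) :: 'a mat"
  have n: "0 < ?n" using assms by simp
  have V: "matV ?n = ?A * (?C * ?A * ?D)"
    unfolding matV_def matB_def matC_inverse[OF n] by simp
  have A: "?A \<in> carrier_mat ?n ?n" by (rule matA_carrier) simp
  have C: "?C \<in> carrier_mat ?n ?n" "?D \<in> carrier_mat ?n ?n" by simp_all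
  have M: "?C * ?A \<in> carrier_mat ?n ?n" "?C * ?A * ?D \<in> carrier_mat ?n ?n"
    using A C by (auto intro!: mult_carrier_mat)
  show "(matV ?n :: 'a mat) \<in> carrier_mat ?n ?n"
    unfolding V using A M(2) by (rule mult_carrier_mat)
  assume v: "v \<in> carrier_vec ?n"
  have Dv: "?D *\<^sub>v v \<in> carrier_vec ?n" "?A *\<^sub>v (?D *\<^sub>v v) \<in> carrier_vec ?n"
    "?C *\<^sub>v (?A *\<^sub>v (?D *\<^sub>v v)) \<in> carrier_vec ?n"
    using A C v by (auto intro!: mult_mat_vec_carrier)
  have "matV ?n *\<^sub>v v = ?A *\<^sub>v (?C *\<^sub>v (?A *\<^sub>v (?D *\<^sub>v v)))"
    unfolding V assoc_mult_mat_vec[OF A M(2) v] assoc_mult_mat_vec[OF M(1) C(2) v]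
      assoc_mult_mat_vec[OF C(1) A Dv(1)] ..
  then show "extend (matV ?n *\<^sub>v v) = opV (extend v)"
    unfolding opV_def using assms n Dv v
    by (simp add: extend_matA extend_matC extend_transpose_matC)
qed

section \<open>Bounding the matrix order\<close>

text \<open>A return on all periodic sequences makes \<open>V^T\<close> fix every vector; applied to
  unit vectors, this gives the columns of the identity matrix.\<close>

lemma mat_order_matV_le:
  assumes l: "0 < l" and T: "1 \<le> T"
    and ret: "\<And>f :: int \<Rightarrow> 'a :: field. periodic (2 * l) f \<Longrightarrow> (opV ^^ T) f = f"
  shows "mat_order (matV (2 * l) :: 'a mat) \<le> T"
proof -
  let ?n = "2 * l" and ?V = "matV (2 * l) :: 'a mat"
  have V: "?V \<in> carrier_mat ?n ?n" by (rule matV_carrier[OF l])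
  have Vk: "?V ^\<^sub>m k \<in> carrier_mat ?n ?n" for k using V by simp
  have ext: "extend (?V ^\<^sub>m k *\<^sub>v v) = (opV ^^ k) (extend v)" if "v \<in> carrier_vec ?n" for k v
    using that
  proof (induction k arbitrary: v)
    case 0
    then show ?case using V by simp
  next
    case (Suc k)
    have Vv: "?V *\<^sub>v v \<in> carrier_vec ?n" using V Suc.prems by (rule mult_mat_vec_carrier)
    have "?V ^\<^sub>m Suc k *\<^sub>v v = ?V ^\<^sub>m k *\<^sub>v (?V *\<^sub>v v)"
      using assoc_mult_mat_vec[OF Vk V Suc.prems] by simp
    then show ?case
      by (simp only: Suc.IH[OF Vv] extend_matV[OF l Suc.prems] funpow_Suc_right comp_apply)
  qed
  have id: "?V ^\<^sub>m T *\<^sub>v v = v" if v: "v \<in> carrier_vec ?n" for v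
  proof (rule eq_vecI)
    have w: "?V ^\<^sub>m T *\<^sub>v v \<in> carrier_vec ?n" using Vk v by (rule mult_mat_vec_carrier)
    show "dim_vec (?V ^\<^sub>m T *\<^sub>v v) = dim_vec v" using w v by (simp only: carrier_vecD)
    fix i assume "i < dim_vec v"
    then have i: "i < ?n" using v by simp
    have "extend (?V ^\<^sub>m T *\<^sub>v v) = extend v"
      unfolding ext[OF v] using periodic_extend[of v] v by (intro ret) simp
    from fun_cong[OF this, of "int i"] show "(?V ^\<^sub>m T *\<^sub>v v) $ i = v $ i"
      using i v w by (simp only: extend_of_nat carrier_vecD mod_less)
  qed
  have "?V ^\<^sub>m T = 1\<^sub>m ?n"
  proof (rule mat_col_eqI)
    fix j assume "j < dim_col (1\<^sub>m ?n :: 'a mat)"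
    then have j: "j < ?n" by simp
    have "col (?V ^\<^sub>m T) j = ?V ^\<^sub>m T *\<^sub>v unit_vec ?n j"
      using col_mult2[OF Vk one_carrier_mat j, of T] right_mult_one_mat[OF Vk, of T] j by simp
    then show "col (?V ^\<^sub>m T) j = col (1\<^sub>m ?n) j" using id[OF unit_vec_carrier] j by simp
  qed (use Vk[of T] in auto)
  then show ?thesis unfolding mat_order_def using T carrier_matD(1)[OF V] by (intro Least_le) simp
qed

theorem corollaryA2:
  fixes p l L :: nat
  assumes "CARD('p :: prime_card) = p"
    and "odd p"
    and "2 \<le> l"
    and "\<not> p dvd l"
    and "L = 2 * l"
  shows "mat_order (matV L :: 'p mod_ring mat) \<le> p ^ (L - 1) - p"
\<comment> \<open>For l = 2 the counting bound is \<open>p^4 - 1\<close>, which exceeds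
  \<open>p^3 - p\<close>, so the eigenspace argument takes over.\<close>
proof (cases "l = 2")
  case True
  have p: "2 \<le> p" using prime_card[where 'a = 'p] assms(1) by (auto dest: prime_ge_2_nat)
  have "mat_order (matV (2 * l) :: 'p mod_ring mat) \<le> 2 * (p * (p - 1))"
    using opV_return_4[where 'p = 'p] p assms(1,2) by (intro mat_order_matV_le) (auto simp: True)
  \<comment> \<open>The target factors as \<open>p^3 - p = (p + 1) * p * (p - 1)\<close>.\<close>
  also have "\<dots> \<le> (p + 1) * (p * (p - 1))" using p by (intro mult_right_mono) auto
  also have "\<dots> = p ^ (L - 1) - p"
    using p by (simp add: assms(5) True eval_nat_numeral algebra_simps diff_mult_distrib2)
  finally show ?thesis by (simp only: assms(5))
next
  case False
  have p: "1 \<le> p" using assms(2) by (auto elim: oddE)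
  have two: "(2 :: 'p mod_ring) \<noteq> 0" using assms(1,2) by (intro two_neq_zero_mod_ring) simp
  have "(4 :: 'p mod_ring) = 2 * 2" by simp
  then have four: "(4 :: 'p mod_ring) \<noteq> 0" using two by (simp only: mult_eq_0_iff simp_thms)
  obtain T where T: "1 \<le> T" "T \<le> p ^ (2 * (l div 2 + 1)) - 1"
    "\<And>f :: int \<Rightarrow> 'p mod_ring. periodic (2 * l) f \<Longrightarrow> (opV ^^ T) f = f"
    using opV_return[OF four, of l] assms(1,3) by auto
  have "mat_order (matV (2 * l) :: 'p mod_ring mat) \<le> T"
    using assms(3) T by (intro mat_order_matV_le) auto
  also have "T \<le> p ^ (2 * l - 2) - 1"
  proof -
    \<comment> \<open>Equality holds for l = 3 and l = 4.\<close>
    have "2 * (l div 2 + 1) \<le> 2 * l - 2" using assms(3) False by presburger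
    then have "p ^ (2 * (l div 2 + 1)) \<le> p ^ (2 * l - 2)" using p by (rule power_increasing)
    with T(2) show ?thesis by linarith
  qed
  \<comment> \<open>The factor p turns the 1 saved by discarding the zero pair into the required
    p.\<close>
  also have "\<dots> \<le> p * (p ^ (2 * l - 2) - 1)" using p by simp
  also have "\<dots> = p ^ Suc (2 * l - 2) - p" by (simp add: diff_mult_distrib2)
  also have "Suc (2 * l - 2) = L - 1" using assms(3,5) by simp
  finally show ?thesis by (simp only: assms(5))
qed

end
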